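(* Let $D=(d_{ij})$ be an $n\times n$ Euclidean distance matrix of embedding dimension $r\le n-2$, and let $z^1,\ldots,z^n\in\mathbb{R}^{n-r-1}$ be Gale transforms of the generating points of $D$. Let $k\neq l$ be indices in $\{1,\ldots,n\}$. Then the entry $d_{kl}$ is unyielding if and only if $z^k$ is not parallel to $z^l$, i.e., if and only if there does not exist a nonzero scalar $c$ such that $z^k=c\,z^l$.
   Context: An $n\times n$ real matrix $D=(d_{ij})$ is a Euclidean distance matrix (EDM) if there exist points $p^1,\ldots,p^n$ in some Euclidean space with $d_{ij}=\|p^i-p^j\|^2$ for all $i,j$; such points are generating points of $D$, and the dimension of their affine span is the embedding dimension $r$ of $D$. For $i\ne j$, $E^{ij}$ is the $n\times n$ symmetric matrix with 1's in the $ij$th and $ji$th entries and 0's elsewhere. For an off-diagonal entry $d_{ij}$, the set of real $t$ such that $D+tE^{ij}$ is an EDM is a closed interval $[l_{ij},u_{ij}]$ with $l_{ij}\le 0\le u_{ij}$ (with $u_{ij}=+\infty$ when $n=2$), called the yielding interval of $d_{ij}$. The entry $d_{ij}$ is unyielding if $l_{ij}=u_{ij}=0$, and yielding otherwise. Let $e\in\mathbb{R}^n$ be the all-ones vector, $J=I_n-ee^T/n$, and $B=-\frac12 JDJ$, which is positive semidefinite of rank $r$. A configuration matrix of $D$ is an $n\times r$ matrix $P$ with $B=PP^T$ (so $P$ has rank $r$ and $P^Te=0$); its rows are $(p^1)^T,\ldots,(p^n)^T$, giving generating points of $D$. For $r\le n-2$, a Gale matrix of $D$ is an $n\times(n-r-1)$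 matrix $Z$ whose columns form a basis of the null space of $\begin{bmatrix}P^T\\ e^T\end{bmatrix}$ (equivalently of $\begin{bmatrix}B\\ e^T\end{bmatrix}$); its rows are $(z^1)^T,\ldots,(z^n)^T$, and $z^1,\ldots,z^n$ are called Gale transforms of $p^1,\ldots,p^n$. Vectors $u,v$ are parallel if $u=cv$ for some nonzero scalar $c$ (in particular two zero vectors are parallel). *)

theory Defs
  imports "HOL-Analysis.Analysis"
begin

section \<open>Euclidean distance matrices\<close>

definition generating_points :: "('n::finite \<Rightarrow> 'a::euclidean_space) \<Rightarrow> real^'n^'n \<Rightarrow> bool" where
  "generating_points p D \<longleftrightarrow> (\<forall>i j. D $ i $ j = (norm (p i - p j))\<^sup>2)"

text \<open>Since one cannot quantify over types inside a formula, the ambient space is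
  taken to be of dimension \<open>n\<close>, which is no restriction: see \<open>is_EDM_iff\<close> and
  \<open>generating_points_imp_is_EDM\<close> below.\<close>

definition is_EDM :: "real^'n^'n \<Rightarrow> bool" where
  "is_EDM D \<longleftrightarrow> (\<exists>p :: 'n \<Rightarrow> real^'n. generating_points p D)"

text \<open>Meaningful only for Euclidean distance matrices; it does not depend on the choice of
  the generating points, nor on their ambient space (see \<open>embedding_dim_eq\<close>).\<close>

definition embedding_dim :: "real^'n^'n \<Rightarrow> nat" where
  "embedding_dim D =
     nat (aff_dim (affine hull range (SOME p :: 'n \<Rightarrow> real^'n. generating_points p D)))"

lemma generating_points_inner:
  assumes "generating_points p D"
  shows "(p i - p a) \<bullet> (p j - p a) = (D $ i $ a + D $ j $ a - D $ i $ j) / 2"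
proof -
  have "(norm (p i - p j))\<^sup>2 = (norm ((p i - p a) - (p j - p a)))\<^sup>2" by simp
  also have "\<dots> = (norm (p i - p a))\<^sup>2 + (norm (p j - p a))\<^sup>2 - 2 * ((p i - p a) \<bullet> (p j - p a))"
    unfolding power2_norm_eq_inner by (simp add: inner_diff inner_commute)
  finally show ?thesis using assms unfolding generating_points_def by simp
qed

lemma generating_points_norm_sum:
  fixes p :: "'n::finite \<Rightarrow> 'a::euclidean_space" and q :: "'n \<Rightarrow> 'b::euclidean_space"
  assumes "generating_points p D" "generating_points q D"
  shows "norm (\<Sum>i\<in>I. c i *\<^sub>R (p i - p a)) = norm (\<Sum>i\<in>I. c i *\<^sub>R (q i - q a))"
  unfolding norm_eq_sqrt_inner
  by (simp add: inner_sum_left inner_sum_right generating_points_inner[OF assms(1)]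
      generating_points_inner[OF assms(2)])

lemma generating_points_aff_dim_le:
  fixes p :: "'n::finite \<Rightarrow> 'a::euclidean_space" and q :: "'n \<Rightarrow> 'b::euclidean_space"
  assumes "generating_points p D" "generating_points q D"
  shows "aff_dim (range p) \<le> aff_dim (range q)"
proof -
  fix a :: 'n
  define v where "v i = p i - p a" for i
  define w where "w i = q i - q a" for i
  obtain B where B: "B \<subseteq> range v" "independent B" "card B = dim (range v)"
    using basis_exists[of "range v"] by metis
  obtain I where I: "inj_on v I" "B = v ` I"
    using B(1) by (meson subset_image_inj)
  have key: "c i = 0" if "(\<Sum>i\<in>I. c i *\<^sub>R w i) = 0" "i \<in> I" for c i
  proof -
    have "(\<Sum>i\<in>I. c i *\<^sub>R v i) = 0"
      using generating_points_norm_sum[OF assms, of c a I] that(1)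
      by (simp add: v_def w_def)
    then have "(\<Sum>b\<in>B. c (the_inv_into I v b) *\<^sub>R b) = 0"
      unfolding I(2) by (simp add: sum.reindex[OF I(1)] the_inv_into_f_f[OF I(1)])
    then have "c (the_inv_into I v (v i)) = 0"
      using B(2) that(2) I(2) by (auto simp: independent_explicit)
    then show ?thesis using that(2) by (simp add: the_inv_into_f_f[OF I(1)])
  qed
  have inj: "inj_on w I"
  proof (rule inj_onI, rule ccontr)
    fix i j assume ij: "i \<in> I" "j \<in> I" "w i = w j" "i \<noteq> j"
    define c where "c x = (if x = i then 1 else if x = j then -1 else 0 :: real)" for x
    have "(\<Sum>x\<in>I. c x *\<^sub>R w x) = (\<Sum>x\<in>{i,j}. c x *\<^sub>R w x)"
      using ij by (intro sum.mono_neutral_right) (auto simp: c_def)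
    also have "\<dots> = 0" using ij by (simp add: c_def)
    finally show False using key[of c i] ij(1) by (simp add: c_def)
  qed
  have "independent (w ` I)"
    unfolding independent_explicit
  proof (intro conjI allI impI ballI)
    fix u b assume u: "(\<Sum>v\<in>w ` I. u v *\<^sub>R v) = 0" and b: "b \<in> w ` I"
    show "u b = 0" using u b key[of "\<lambda>i. u (w i)"] by (auto simp: sum.reindex[OF inj])
  qed simp
  then have "card (w ` I) \<le> dim (range w)"
    by (intro independent_card_le_dim) auto
  then have "dim (range v) \<le> dim (range w)"
    using B(3) by (simp add: I(2) card_image[OF I(1)] card_image[OF inj])
  moreover have "aff_dim (range p) = dim (range v)"
    using aff_dim_eq_dim_subtract[of "p a" "range p"] unfolding image_image v_def
    by (simp add: hull_inc)
  moreover have "aff_dim (range q) = dim (range w)"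
    using aff_dim_eq_dim_subtract[of "q a" "range q"] unfolding image_image w_def
    by (simp add: hull_inc)
  ultimately show ?thesis by simp
qed

lemma generating_points_imp_is_EDM:
  fixes p :: "'n::finite \<Rightarrow> 'a::euclidean_space"
  assumes "generating_points p D"
  shows "is_EDM D"
proof -
  fix a :: 'n
  define S where "S = span (range (\<lambda>i. p i - p a))"
  have "dim S \<le> card (range (\<lambda>i. p i - p a))"
    unfolding S_def dim_span by (rule dim_le_card') simp
  also have "\<dots> \<le> CARD('n)" by (rule card_image_le) simp
  finally have "dim S \<le> dim (UNIV :: (real^'n) set)" by simp
  then obtain f :: "'a \<Rightarrow> real^'n" where f: "linear f" "\<And>x. x \<in> S \<Longrightarrow> norm (f x) = norm x"
    using isometry_subset_subspace[of S "UNIV :: (real^'n) set"] by (auto simp: S_def)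
  have "norm (f (p i) - f (p j)) = norm (p i - p j)" for i j
  proof -
    have "(p i - p a) - (p j - p a) \<in> S"
      unfolding S_def by (intro span_diff span_base) auto
    then show ?thesis using f by (simp add: linear_diff[symmetric])
  qed
  then have "generating_points (\<lambda>i. f (p i)) D"
    using assms by (simp add: generating_points_def)
  then show ?thesis by (auto simp: is_EDM_def)
qed

lemma is_EDM_iff:
  "is_EDM (D :: real^'n^'n) \<longleftrightarrow>
     (\<exists>m. \<exists>p :: 'n \<Rightarrow> nat \<Rightarrow> real. \<forall>i j. D $ i $ j = (\<Sum>a<m. (p i a - p j a)\<^sup>2))"
proof
  assume "is_EDM D"
  then obtain p :: "'n \<Rightarrow> real^'n" where p: "generating_points p D" by (auto simp: is_EDM_def)
  obtain h where h: "bij_betw h {..<CARD('n)} (UNIV :: 'n set)"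
    using ex_bij_betw_nat_finite[of "UNIV :: 'n set"] by (auto simp: atLeast0LessThan)
  have "D $ i $ j = (\<Sum>a<CARD('n). (p i $ h a - p j $ h a)\<^sup>2)" for i j
  proof -
    have "D $ i $ j = (\<Sum>b\<in>UNIV. (p i $ b - p j $ b)\<^sup>2)"
      using p unfolding generating_points_def power2_norm_eq_inner inner_vec_def
      by (simp add: power2_eq_square)
    also have "\<dots> = (\<Sum>a<CARD('n). (p i $ h a - p j $ h a)\<^sup>2)"
      by (rule sum.reindex_bij_betw[OF h, symmetric])
    finally show ?thesis .
  qed
  then show "\<exists>m. \<exists>p :: 'n \<Rightarrow> nat \<Rightarrow> real. \<forall>i j. D $ i $ j = (\<Sum>a<m. (p i a - p j a)\<^sup>2)"
    by (intro exI[of _ "CARD('n)"] exI[of _ "\<lambda>i a. p i $ h a"]) simp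
next
  assume "\<exists>m. \<exists>p :: 'n \<Rightarrow> nat \<Rightarrow> real. \<forall>i j. D $ i $ j = (\<Sum>a<m. (p i a - p j a)\<^sup>2)"
  then obtain m and p :: "'n \<Rightarrow> nat \<Rightarrow> real"
    where p: "\<And>i j. D $ i $ j = (\<Sum>a<m. (p i a - p j a)\<^sup>2)" by blast
  have "\<exists>q :: 'n \<Rightarrow> real^'n. \<forall>i j. (norm (q i - q j))\<^sup>2 = (\<Sum>a<m. (p i a - p j a)\<^sup>2)"
  proof (induction m)
    case 0
    show ?case by (intro exI[of _ "\<lambda>_. 0"]) simp
  next
    case (Suc m)
    then obtain q :: "'n \<Rightarrow> real^'n"
      where q: "\<And>i j. (norm (q i - q j))\<^sup>2 = (\<Sum>a<m. (p i a - p j a)\<^sup>2)" by blast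
    define D' :: "real^'n^'n" where "D' = (\<chi> i j. \<Sum>a<Suc m. (p i a - p j a)\<^sup>2)"
    have "generating_points (\<lambda>i. (q i, p i m)) D'"
      by (simp add: generating_points_def D'_def norm_Pair q sum_nonneg)
    then have "is_EDM D'" by (rule generating_points_imp_is_EDM)
    then show ?case by (auto simp: is_EDM_def generating_points_def D'_def)
  qed
  then show "is_EDM D" unfolding is_EDM_def generating_points_def p by metis
qed

lemma embedding_dim_eq:
  fixes p :: "'n::finite \<Rightarrow> 'a::euclidean_space"
  assumes "generating_points p D"
  shows "int (embedding_dim D) = aff_dim (affine hull range p)"
proof -
  define q :: "'n \<Rightarrow> real^'n" where "q = (SOME p. generating_points p D)"
  have q: "generating_points q D"
    unfolding q_def using generating_points_imp_is_EDM[OF assms] unfolding is_EDM_def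
    by (rule someI_ex)
  have "aff_dim (range q) = aff_dim (range p)"
    using generating_points_aff_dim_le[OF assms q] generating_points_aff_dim_le[OF q assms]
    by simp
  moreover have "aff_dim (range p) \<ge> 0"
    using aff_dim_negative_iff[of "range p"] by (simp add: not_less[symmetric])
  ultimately show ?thesis by (simp add: embedding_dim_def q_def)
qed


section \<open>Configuration matrices and Gale matrices\<close>

definition centering_matrix :: "real^'n^'n" where
  "centering_matrix = mat 1 - (1 / real CARD('n)) *\<^sub>R (\<chi> i j. 1)"

definition gram_matrix :: "real^'n^'n \<Rightarrow> real^'n^'n" where
  "gram_matrix D = (- 1 / 2) *\<^sub>R (centering_matrix ** D ** centering_matrix)"

text \<open>The number \<open>r\<close> of columns of a configuration matrix depends on \<open>D\<close> and may be \<open>0\<close>,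
  so it cannot be the cardinality of an index type. The \<open>n \<times> r\<close> matrix \<open>P\<close> is given by its
  entries \<open>P i a\<close> with \<open>a < r\<close>; the values for \<open>a \<ge> r\<close> are irrelevant.\<close>

definition configuration_matrix :: "real^'n^'n \<Rightarrow> ('n \<Rightarrow> nat \<Rightarrow> real) \<Rightarrow> bool" where
  "configuration_matrix D P \<longleftrightarrow>
     (\<forall>i j. gram_matrix D $ i $ j = (\<Sum>a<embedding_dim D. P i a * P j a))"

text \<open>The null space of the matrix with the \<open>r + 1\<close> rows given by \<open>P\<^sup>T\<close> and \<open>e\<^sup>T\<close>.\<close>

definition gale_space :: "nat \<Rightarrow> ('n::finite \<Rightarrow> nat \<Rightarrow> real) \<Rightarrow> (real^'n) set" where
  "gale_space r P =
     {x. (\<forall>a<r. (\<Sum>i\<in>UNIV. P i a * x $ i) = 0) \<and> (\<Sum>i\<in>UNIV. x $ i) = 0}"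

text \<open>The Gale transforms are the rows of \<open>Z\<close>. Injectivity of \<open>column\<close> is needed because
  \<open>columns Z\<close> is a set, which does not see repeated columns.\<close>

definition gale_matrix :: "real^'n^'n \<Rightarrow> ('n \<Rightarrow> nat \<Rightarrow> real) \<Rightarrow> real^'m^'n \<Rightarrow> bool" where
  "gale_matrix D P Z \<longleftrightarrow>
     CARD('m) + embedding_dim D + 1 = CARD('n) \<and>
     inj (\<lambda>j. column j Z) \<and> independent (columns Z) \<and>
     span (columns Z) = gale_space (embedding_dim D) P"

definition parallel :: "'a::real_vector \<Rightarrow> 'a \<Rightarrow> bool" where
  "parallel u v \<longleftrightarrow> (\<exists>c::real. c \<noteq> 0 \<and> u = c *\<^sub>R v)"


section \<open>Yielding intervals\<close>

definition E_matrix :: "'n \<Rightarrow> 'n \<Rightarrow> real^'n^'n" where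
  "E_matrix i j = (\<chi> a b. if (a = i \<and> b = j) \<or> (a = j \<and> b = i) then 1 else 0)"

definition yielding_interval :: "real^'n^'n \<Rightarrow> 'n \<Rightarrow> 'n \<Rightarrow> real set" where
  "yielding_interval D i j = {t. is_EDM (D + t *\<^sub>R E_matrix i j)}"

definition yielding_lower :: "real^'n^'n \<Rightarrow> 'n \<Rightarrow> 'n \<Rightarrow> ereal" where
  "yielding_lower D i j = (INF t\<in>yielding_interval D i j. ereal t)"

definition yielding_upper :: "real^'n^'n \<Rightarrow> 'n \<Rightarrow> 'n \<Rightarrow> ereal" where
  "yielding_upper D i j = (SUP t\<in>yielding_interval D i j. ereal t)"

definition unyielding :: "real^'n^'n \<Rightarrow> 'n \<Rightarrow> 'n \<Rightarrow> bool" where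
  "unyielding D i j \<longleftrightarrow> yielding_lower D i j = 0 \<and> yielding_upper D i j = 0"

end

theory Submission
  imports Defs
begin

text \<open>Fix generating points \<open>p\<close> of \<open>D\<close>. A vector \<open>x\<close> whose coordinates sum to zero satisfies
  \<open>x\<^sup>T D x = - 2 \<parallel>\<Sum>\<^sub>i x\<^sub>i p\<^sub>i\<parallel>\<^sup>2\<close>, so the space \<open>G\<close> spanned by the columns of a Gale matrix
  consists of the affine dependences of the points: the vectors \<open>x\<close> with \<open>\<Sum>\<^sub>i x\<^sub>i = 0\<close> and
  \<open>\<Sum>\<^sub>i x\<^sub>i p\<^sub>i = 0\<close> (\<open>gale_space_eq_affine_dependences\<close>). The rows \<open>k\<close> and \<open>l\<close> of the Gale
  matrix represent the coordinate functionals \<open>x\<^sub>k\<close> and \<open>x\<^sub>l\<close> on \<open>G\<close>, and parallelism of these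
  rows means two equivalent things: the functionals are proportional with a nonzero factor,
  or they have the same kernel in \<open>G\<close>.

  If \<open>D + t E\<^sup>k\<^sup>l\<close> is a Euclidean distance matrix, then \<open>t x\<^sub>k x\<^sub>l \<le> \<parallel>\<Sum>\<^sub>i x\<^sub>i p\<^sub>i\<parallel>\<^sup>2\<close> whenever
  \<open>\<Sum>\<^sub>i x\<^sub>i = 0\<close>. Moving along the line through \<open>e\<^sub>k - e\<^sub>l\<close> in the direction of an \<open>x \<in> G\<close> with
  \<open>x\<^sub>k x\<^sub>l = 0\<close> leaves the right-hand side constant, whereas the left-hand side is affine with slope
  \<open>t (x\<^sub>l - x\<^sub>k)\<close>. Hence \<open>t \<noteq> 0\<close> forces \<open>x\<^sub>k = x\<^sub>l = 0\<close>: the two functionals have the same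
  kernel (\<open>perturbed_EDM_imp_same_kernel\<close>).

  Conversely, if \<open>x\<^sub>k = c x\<^sub>l\<close> on \<open>G\<close>, then \<open>e\<^sub>k - c e\<^sub>l\<close> is orthogonal to \<open>G\<close>, so it is the
  restriction of an affine function \<open>y \<mapsto> w \<bullet> y + \<alpha>\<close> to the points. Contracting the points in
  the direction \<open>w\<close> lowers the squared distances by a multiple of the squared differences of
  \<open>e\<^sub>k - c e\<^sub>l\<close>, and an additional coordinate proportional to \<open>e\<^sub>k + c e\<^sub>l\<close> raises them by the
  same multiple of the squared differences of that vector. The two effects cancel except in the
  entry of \<open>k\<close> and \<open>l\<close>, which changes by a nonzero amount
  (\<open>proportional_coordinates_imp_perturbed_EDM\<close>).\<close>

lemma unyielding_iff:
  fixes D :: "real^'n^'n"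
  assumes "is_EDM D"
  shows "unyielding D k l \<longleftrightarrow> (\<forall>t. is_EDM (D + t *\<^sub>R E_matrix k l) \<longrightarrow> t = 0)"
proof
  assume u: "unyielding D k l"
  show "\<forall>t. is_EDM (D + t *\<^sub>R E_matrix k l) \<longrightarrow> t = 0"
  proof (intro allI impI)
    fix t assume "is_EDM (D + t *\<^sub>R E_matrix k l)"
    then have t: "t \<in> yielding_interval D k l" by (simp add: yielding_interval_def)
    have "0 \<le> ereal t" "ereal t \<le> 0"
      using u INF_lower[OF t, of ereal] SUP_upper[OF t, of ereal]
      by (simp_all add: unyielding_def yielding_lower_def yielding_upper_def)
    then show "t = 0" by simp
  qed
next
  assume "\<forall>t. is_EDM (D + t *\<^sub>R E_matrix k l) \<longrightarrow> t = 0"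
  then have "yielding_interval D k l = {0}"
    using assms by (auto simp: yielding_interval_def)
  then show "unyielding D k l"
    by (simp add: unyielding_def yielding_lower_def yielding_upper_def zero_ereal_def)
qed

lemma generating_points_quadratic_form:
  fixes D :: "real^'n^'n" and p :: "'n \<Rightarrow> 'a::euclidean_space"
  assumes "generating_points p D" and "(\<Sum>i\<in>UNIV. x $ i) = 0"
  shows "x \<bullet> (D *v x) = - 2 * (norm (\<Sum>i\<in>UNIV. x $ i *\<^sub>R p i))\<^sup>2"
proof -
  have D: "D $ i $ j = p i \<bullet> p i + p j \<bullet> p j - 2 * (p i \<bullet> p j)" for i j
    using assms(1) unfolding generating_points_def power2_norm_eq_inner
    by (simp add: inner_diff inner_commute)
  have "x \<bullet> (D *v x) = (\<Sum>i\<in>UNIV. \<Sum>j\<in>UNIV. x $ i * (D $ i $ j * x $ j))"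
    by (simp add: inner_vec_def matrix_vector_mult_def sum_distrib_left)
  also have "\<dots> = (\<Sum>i\<in>UNIV. \<Sum>j\<in>UNIV. (x $ i * (p i \<bullet> p i)) * x $ j)
      + (\<Sum>i\<in>UNIV. \<Sum>j\<in>UNIV. x $ i * (x $ j * (p j \<bullet> p j)))
      - 2 * (\<Sum>i\<in>UNIV. \<Sum>j\<in>UNIV. x $ i * (x $ j * (p i \<bullet> p j)))"
    by (simp add: D algebra_simps sum.distrib sum_subtractf sum_distrib_left)
  also have "(\<Sum>i\<in>UNIV. \<Sum>j\<in>UNIV. (x $ i * (p i \<bullet> p i)) * x $ j) = 0"
    by (simp add: sum_distrib_left[symmetric] assms(2))
  also have "(\<Sum>i\<in>UNIV. \<Sum>j\<in>UNIV. x $ i * (x $ j * (p j \<bullet> p j))) = 0"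
    by (simp add: sum_distrib_left[symmetric] sum_distrib_right[symmetric] assms(2))
  also have "(\<Sum>i\<in>UNIV. \<Sum>j\<in>UNIV. x $ i * (x $ j * (p i \<bullet> p j)))
      = (norm (\<Sum>i\<in>UNIV. x $ i *\<^sub>R p i))\<^sup>2"
    by (simp add: power2_norm_eq_inner inner_sum_left inner_sum_right sum_distrib_left
        inner_commute mult.left_commute)
  finally show ?thesis by simp
qed

lemma E_matrix_quadratic_form:
  fixes x :: "real^'n"
  assumes "k \<noteq> l"
  shows "x \<bullet> (E_matrix k l *v x) = 2 * (x $ k * x $ l)"
proof -
  have "(E_matrix k l *v x) $ a = (if a = k then x $ l else 0) + (if a = l then x $ k else 0)" for a
  proof -
    have "(E_matrix k l *v x) $ a
        = (\<Sum>b\<in>UNIV. (if b = l then if a = k then x $ l else 0 else 0)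
                 + (if b = k then if a = l then x $ k else 0 else 0))"
      unfolding matrix_vector_mult_def E_matrix_def
      using assms by (auto simp: if_distrib[of "\<lambda>y. y * _"] cong: if_cong)
    then show ?thesis by (simp add: sum.distrib)
  qed
  then show ?thesis
    by (simp add: inner_vec_def distrib_left sum.distrib if_distrib[of "\<lambda>y. _ * y"] cong: if_cong)
qed

lemma centering_matrix_mult_vec:
  assumes "(\<Sum>i\<in>UNIV. x $ i) = 0"
  shows "centering_matrix *v x = x"
proof -
  have "(\<chi> i j. 1) *v x = (0 :: real^'n)"
    using assms by (simp add: vec_eq_iff matrix_vector_mult_def)
  then show ?thesis
    by (simp add: centering_matrix_def matrix_vector_mult_diff_rdistrib
        scaleR_matrix_vector_assoc[symmetric])
qed

lemma transpose_centering_matrix: "transpose centering_matrix = centering_matrix"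
  by (auto simp: transpose_def centering_matrix_def mat_def vec_eq_iff)

lemma gram_matrix_quadratic_form:
  fixes D :: "real^'n^'n"
  assumes "(\<Sum>i\<in>UNIV. x $ i) = 0"
  shows "x \<bullet> (gram_matrix D *v x) = - (x \<bullet> (D *v x)) / 2"
proof -
  let ?J = "centering_matrix :: real^'n^'n"
  have "x \<bullet> ((?J ** D ** ?J) *v x) = x \<bullet> (?J *v (D *v (?J *v x)))"
    by (simp add: matrix_vector_mul_assoc matrix_mul_assoc)
  also have "\<dots> = (transpose ?J *v x) \<bullet> (D *v (?J *v x))"
    by (simp add: dot_lmul_matrix[symmetric])
  also have "\<dots> = x \<bullet> (D *v x)"
    by (simp add: transpose_centering_matrix centering_matrix_mult_vec[OF assms])
  finally have "x \<bullet> ((?J ** D ** ?J) *v x) = x \<bullet> (D *v x)" .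
  then show ?thesis
    by (simp add: gram_matrix_def scaleR_matrix_vector_assoc[symmetric] inner_diff
        del: scaleR_minus_left)
qed

text \<open>For \<open>x\<close> with coordinate sum zero, \<open>\<parallel>P\<^sup>T x\<parallel>\<^sup>2 = x\<^sup>T B x = \<parallel>\<Sum>\<^sub>i x\<^sub>i p\<^sub>i\<parallel>\<^sup>2\<close>, where \<open>B\<close> is the
  Gram matrix. So the null space does not depend on the factorization of \<open>B\<close>, and arbitrary
  generating points may replace the rows of \<open>P\<close>.\<close>

lemma gale_space_eq_affine_dependences:
  fixes D :: "real^'n^'n" and p :: "'n \<Rightarrow> 'a::euclidean_space"
  assumes "configuration_matrix D P" and "generating_points p D"
  shows "gale_space (embedding_dim D) P
    = {x. (\<Sum>i\<in>UNIV. x $ i) = 0 \<and> (\<Sum>i\<in>UNIV. x $ i *\<^sub>R p i) = 0}"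
proof -
  let ?r = "embedding_dim D"
  have "(\<forall>a<?r. (\<Sum>i\<in>UNIV. P i a * x $ i) = 0) \<longleftrightarrow> (\<Sum>i\<in>UNIV. x $ i *\<^sub>R p i) = 0"
    if x: "(\<Sum>i\<in>UNIV. x $ i) = 0" for x
  proof -
    have "x \<bullet> (gram_matrix D *v x)
        = (\<Sum>i\<in>UNIV. \<Sum>j\<in>UNIV. \<Sum>a<?r. (P i a * x $ i) * (P j a * x $ j))"
      using assms(1) unfolding configuration_matrix_def
      by (simp add: inner_vec_def matrix_vector_mult_def sum_distrib_left sum_distrib_right
          algebra_simps)
    also have "\<dots> = (\<Sum>i\<in>UNIV. \<Sum>a<?r. \<Sum>j\<in>UNIV. (P i a * x $ i) * (P j a * x $ j))"
      by (intro sum.cong sum.swap refl)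
    also have "\<dots> = (\<Sum>a<?r. \<Sum>i\<in>UNIV. \<Sum>j\<in>UNIV. (P i a * x $ i) * (P j a * x $ j))"
      by (rule sum.swap)
    also have "\<dots> = (\<Sum>a<?r. (\<Sum>i\<in>UNIV. P i a * x $ i)\<^sup>2)"
      by (simp add: power2_eq_square sum_product)
    finally have "(\<Sum>a<?r. (\<Sum>i\<in>UNIV. P i a * x $ i)\<^sup>2) = (norm (\<Sum>i\<in>UNIV. x $ i *\<^sub>R p i))\<^sup>2"
      using gram_matrix_quadratic_form[OF x, of D] generating_points_quadratic_form[OF assms(2) x]
      by simp
    moreover have "(\<forall>a<?r. (\<Sum>i\<in>UNIV. P i a * x $ i) = 0)
        \<longleftrightarrow> (\<Sum>a<?r. (\<Sum>i\<in>UNIV. P i a * x $ i)\<^sup>2) = 0"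
      by (subst sum_nonneg_eq_0_iff) auto
    ultimately show ?thesis by simp
  qed
  then show ?thesis by (auto simp: gale_space_def)
qed

lemma nth_mult_vec_eq_inner_row: "(Z *v \<xi>) $ k = row k Z \<bullet> (\<xi> :: real^'m)"
  by (simp add: inner_vec_def matrix_vector_mult_def row_def)

lemma span_columns_eq_range:
  fixes Z :: "real^'m^'n"
  shows "span (columns Z) = range (\<lambda>\<xi>. Z *v \<xi>)"
proof
  show "range (\<lambda>\<xi>. Z *v \<xi>) \<subseteq> span (columns Z)"
    using matrix_vector_mult_in_columnspace[of Z] by auto
  have "columns Z \<subseteq> range (\<lambda>\<xi>. Z *v \<xi>)"
    using matrix_vector_mul_component
    by (auto simp: columns_def matrix_vector_mult_basis[symmetric])
  then show "span (columns Z) \<subseteq> range (\<lambda>\<xi>. Z *v \<xi>)"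
    by (intro span_minimal linear_subspace_image) auto
qed

lemma parallel_rows_imp_proportional_coordinates:
  fixes Z :: "real^'m^'n"
  assumes "parallel (row k Z) (row l Z)"
  obtains c where "c \<noteq> 0" "\<And>x. x \<in> span (columns Z) \<Longrightarrow> x $ k = c * x $ l"
proof -
  obtain c where "c \<noteq> 0" "row k Z = c *\<^sub>R row l Z"
    using assms by (auto simp: parallel_def)
  then show thesis
    by (intro that[of c]) (auto simp: span_columns_eq_range nth_mult_vec_eq_inner_row)
qed

lemma parallel_if_same_orthogonal_vectors:
  fixes u v :: "'a::real_inner"
  assumes "\<And>\<xi>. u \<bullet> \<xi> = 0 \<longleftrightarrow> v \<bullet> \<xi> = 0"
  shows "parallel u v"
proof (cases "v = 0")
  case True
  then have "u = 0" using assms[of u] by simp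
  then show ?thesis using True by (auto simp: parallel_def intro: exI[of _ 1])
next
  case False
  then have "u \<noteq> 0" using assms[of v] by auto
  define c where "c = (u \<bullet> v) / (v \<bullet> v)"
  \<comment> \<open>The component of \<open>u\<close> orthogonal to \<open>v\<close> is orthogonal to \<open>u\<close> as well, hence zero.\<close>
  define \<xi> where "\<xi> = u - c *\<^sub>R v"
  have "v \<bullet> \<xi> = 0" using False by (simp add: \<xi>_def c_def inner_diff inner_commute)
  then have "\<xi> \<bullet> \<xi> = 0" using assms[of \<xi>] by (subst (1) \<xi>_def) (simp add: inner_diff_left)
  then have "u = c *\<^sub>R v" by (simp add: \<xi>_def)
  then show ?thesis using \<open>u \<noteq> 0\<close> by (auto simp: parallel_def)
qed

lemma parallel_rows_if_same_kernel:
  fixes Z :: "real^'m^'n"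
  assumes "\<And>x. x \<in> span (columns Z) \<Longrightarrow> x $ k = 0 \<longleftrightarrow> x $ l = 0"
  shows "parallel (row k Z) (row l Z)"
proof (rule parallel_if_same_orthogonal_vectors)
  show "row k Z \<bullet> \<xi> = 0 \<longleftrightarrow> row l Z \<bullet> \<xi> = 0" for \<xi>
    using assms[of "Z *v \<xi>"] by (simp add: span_columns_eq_range nth_mult_vec_eq_inner_row)
qed

lemma perturbed_EDM_imp_bound:
  fixes D :: "real^'n^'n" and p :: "'n \<Rightarrow> 'a::euclidean_space"
  assumes "generating_points p D" and "is_EDM (D + t *\<^sub>R E_matrix k l)" and "k \<noteq> l"
    and "(\<Sum>i\<in>UNIV. x $ i) = 0"
  shows "t * (x $ k * x $ l) \<le> (norm (\<Sum>i\<in>UNIV. x $ i *\<^sub>R p i))\<^sup>2"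
proof -
  obtain q :: "'n \<Rightarrow> real^'n" where q: "generating_points q (D + t *\<^sub>R E_matrix k l)"
    using assms(2) by (auto simp: is_EDM_def)
  have "x \<bullet> ((D + t *\<^sub>R E_matrix k l) *v x) \<le> 0"
    by (simp add: generating_points_quadratic_form[OF q assms(4)])
  then show ?thesis
    by (simp add: matrix_vector_mult_add_rdistrib inner_add_right
        scaleR_matrix_vector_assoc[symmetric] E_matrix_quadratic_form[OF assms(3)]
        generating_points_quadratic_form[OF assms(1,4)])
qed

text \<open>On the line \<open>e\<^sub>k - e\<^sub>l + s x\<close> the bound above has the constant right-hand side
  \<open>\<parallel>p\<^sub>k - p\<^sub>l\<parallel>\<^sup>2\<close>. An affine function of \<open>s\<close> is bounded above only if its slope vanishes.\<close>

lemma perturbed_EDM_imp_same_kernel: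
  fixes D :: "real^'n^'n" and p :: "'n \<Rightarrow> 'a::euclidean_space"
  assumes "generating_points p D" and "is_EDM (D + t *\<^sub>R E_matrix k l)" and "k \<noteq> l" and "t \<noteq> 0"
    and x: "(\<Sum>i\<in>UNIV. x $ i) = 0" "(\<Sum>i\<in>UNIV. x $ i *\<^sub>R p i) = 0"
  shows "x $ k = 0 \<longleftrightarrow> x $ l = 0"
proof (rule ccontr)
  assume "\<not> ?thesis"
  then have prod: "x $ k * x $ l = 0" and slope: "t * (x $ l - x $ k) \<noteq> 0"
    using assms(4) by auto
  define M where "M = (norm (p k - p l))\<^sup>2"
  define s where "s = (M + t + 1) / (t * (x $ l - x $ k))"
  define y :: "real^'n" where "y = axis k 1 - axis l 1 + s *\<^sub>R x"
  have "(\<Sum>i\<in>UNIV. y $ i) = 0"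
    by (simp add: y_def axis_def sum.distrib sum_subtractf sum_distrib_left[symmetric] x(1))
  moreover have "(\<Sum>i\<in>UNIV. y $ i *\<^sub>R p i) = p k - p l"
  proof -
    have "(\<Sum>i\<in>UNIV. y $ i *\<^sub>R p i)
        = (\<Sum>i\<in>UNIV. if i = k then p i else 0) - (\<Sum>i\<in>UNIV. if i = l then p i else 0)
          + s *\<^sub>R (\<Sum>i\<in>UNIV. x $ i *\<^sub>R p i)"
      unfolding scaleR_sum_right sum_subtractf[symmetric] sum.distrib[symmetric]
      by (intro sum.cong) (auto simp: y_def axis_def algebra_simps)
    then show ?thesis by (simp add: x(2))
  qed
  ultimately have "t * (y $ k * y $ l) \<le> M"
    using perturbed_EDM_imp_bound[OF assms(1-3), of y] by (simp add: M_def)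
  moreover have "y $ k * y $ l = - 1 + s * (x $ l - x $ k) + s * s * (x $ k * x $ l)"
    using assms(3) by (simp add: y_def axis_def algebra_simps)
  ultimately have "s * (t * (x $ l - x $ k)) \<le> M + t"
    by (simp add: prod algebra_simps)
  then show False using slope by (simp add: s_def)
qed

text \<open>The values of affine functions at the points form a subspace of \<open>\<real>\<^sup>n\<close> whose orthogonal
  complement is the space of affine dependences, and a subspace is its own double orthogonal
  complement.\<close>

lemma orthogonal_to_affine_dependences_imp_affine_function:
  fixes g :: "real^'n" and p :: "'n \<Rightarrow> 'a::euclidean_space"
  assumes "\<And>x. \<lbrakk>(\<Sum>i\<in>UNIV. x $ i) = 0; (\<Sum>i\<in>UNIV. x $ i *\<^sub>R p i) = 0\<rbrakk> \<Longrightarrow> g \<bullet> x = 0"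
  obtains w \<alpha> where "\<And>i. g $ i = w \<bullet> p i + \<alpha>"
proof -
  define F :: "'a \<times> real \<Rightarrow> real^'n" where "F = (\<lambda>(w, \<alpha>). \<chi> i. w \<bullet> p i + \<alpha>)"
  have F: "F (w, \<alpha>) $ i = w \<bullet> p i + \<alpha>" for w \<alpha> i by (simp add: F_def)
  have "linear F"
    by (rule linearI) (auto simp: F_def vec_eq_iff inner_add_left algebra_simps)
  then have "subspace (range F)"
    by (intro linear_subspace_image) auto
  have "g \<in> orthogonal_comp (orthogonal_comp (range F))"
    unfolding orthogonal_comp_def[of "orthogonal_comp (range F)"]
  proof (safe, unfold orthogonal_def)
    fix x assume "x \<in> orthogonal_comp (range F)"
    then have "F u \<bullet> x = 0" for u
      unfolding orthogonal_comp_def orthogonal_def by blast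
    from this[of "(_, _)"] have orth: "(\<Sum>i\<in>UNIV. (w \<bullet> p i + \<alpha>) * x $ i) = 0" for w \<alpha>
      by (simp add: F_def inner_vec_def)
    let ?L = "\<Sum>i\<in>UNIV. x $ i *\<^sub>R p i"
    have "(\<Sum>i\<in>UNIV. x $ i) = 0" using orth[of 0 1] by simp
    moreover have "?L \<bullet> ?L = 0"
    proof -
      have "?L \<bullet> ?L = (\<Sum>i\<in>UNIV. ?L \<bullet> (x $ i *\<^sub>R p i))" by (rule inner_sum_right)
      then show ?thesis using orth[of ?L 0] by (simp add: mult.commute)
    qed
    ultimately show "x \<bullet> g = 0" using assms[of x] by (simp add: inner_commute)
  qed
  then have "g \<in> range F"
    using orthogonal_comp_self[OF \<open>subspace (range F)\<close>] by simp
  then obtain w \<alpha> where "g = F (w, \<alpha>)" by auto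
  then show thesis using that F by auto
qed

lemma norm_contraction_squared:
  fixes w v :: "'a::real_inner"
  shows "(norm (v - (\<beta> * (w \<bullet> v)) *\<^sub>R w))\<^sup>2 = (norm v)\<^sup>2 - \<beta> * (2 - \<beta> * (w \<bullet> w)) * (w \<bullet> v)\<^sup>2"
  unfolding power2_norm_eq_inner
  by (simp add: inner_diff inner_commute[of v w] algebra_simps power2_eq_square)

text \<open>With \<open>f = e\<^sub>k + c e\<^sub>l\<close> and \<open>g = e\<^sub>k - c e\<^sub>l\<close>, the identity
  \<open>(f\<^sub>i - f\<^sub>j)\<^sup>2 - (g\<^sub>i - g\<^sub>j)\<^sup>2 = - 4 c E\<^sub>i\<^sub>j\<close> holds for the entries of \<open>E = E\<^sup>k\<^sup>l\<close>. So it
  suffices to replace a positive multiple of \<open>(g\<^sub>i - g\<^sub>j)\<^sup>2\<close> in the squared distances by the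
  same multiple of \<open>(f\<^sub>i - f\<^sub>j)\<^sup>2\<close>.\<close>

lemma proportional_coordinates_imp_perturbed_EDM:
  fixes D :: "real^'n^'n" and p :: "'n \<Rightarrow> 'a::euclidean_space"
  assumes "generating_points p D" and "k \<noteq> l" and "c \<noteq> 0"
    and proportional: "\<And>x. \<lbrakk>(\<Sum>i\<in>UNIV. x $ i) = 0; (\<Sum>i\<in>UNIV. x $ i *\<^sub>R p i) = 0\<rbrakk> \<Longrightarrow> x $ k = c * x $ l"
  obtains t where "t \<noteq> 0" "is_EDM (D + t *\<^sub>R E_matrix k l)"
proof -
  define g :: "real^'n" where "g = axis k 1 - c *\<^sub>R axis l 1"
  define f :: "real^'n" where "f = axis k 1 + c *\<^sub>R axis l 1"
  have "g \<bullet> x = x $ k - c * x $ l" for x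
    by (simp add: g_def inner_diff_left inner_axis')
  then obtain w \<alpha> where w: "\<And>i. g $ i = w \<bullet> p i + \<alpha>"
    using orthogonal_to_affine_dependences_imp_affine_function[of p g] proportional by auto
  \<comment> \<open>The value of \<open>\<beta>\<close> makes \<open>\<gamma>\<close> positive, also when \<open>w = 0\<close>.\<close>
  define \<beta> where "\<beta> = 1 / (1 + w \<bullet> w)"
  define \<gamma> where "\<gamma> = \<beta> * (2 - \<beta> * (w \<bullet> w))"
  have "1 + w \<bullet> w > 0" by (simp add: add_pos_nonneg)
  then have "\<beta> > 0" "\<beta> * (w \<bullet> w) < 1" by (simp_all add: \<beta>_def)
  then have "\<gamma> > 0" by (simp add: \<gamma>_def)
  define q where "q i = (p i - (\<beta> * (w \<bullet> p i)) *\<^sub>R w, sqrt \<gamma> * f $ i)" for i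
  have "(norm (q i - q j))\<^sup>2 = (D + (- 4 * c * \<gamma>) *\<^sub>R E_matrix k l) $ i $ j" for i j
  proof -
    have "q i - q j = ((p i - p j) - (\<beta> * (w \<bullet> (p i - p j))) *\<^sub>R w, sqrt \<gamma> * (f $ i - f $ j))"
      by (simp add: q_def inner_diff_right algebra_simps)
    then have "(norm (q i - q j))\<^sup>2
        = (norm ((p i - p j) - (\<beta> * (w \<bullet> (p i - p j))) *\<^sub>R w))\<^sup>2 + (sqrt \<gamma> * (f $ i - f $ j))\<^sup>2"
      by (simp add: norm_Pair)
    also have "\<dots>
        = D $ i $ j - \<gamma> * (w \<bullet> (p i - p j))\<^sup>2 + \<gamma> * (f $ i - f $ j)\<^sup>2"
      using assms(1) \<open>\<gamma> > 0\<close>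
      by (simp add: norm_contraction_squared generating_points_def \<gamma>_def[symmetric]
          power_mult_distrib)
    also have "w \<bullet> (p i - p j) = g $ i - g $ j" by (simp add: w inner_diff_right)
    also have "D $ i $ j - \<gamma> * (g $ i - g $ j)\<^sup>2 + \<gamma> * (f $ i - f $ j)\<^sup>2
        = D $ i $ j + \<gamma> * ((f $ i - f $ j)\<^sup>2 - (g $ i - g $ j)\<^sup>2)"
      by (simp add: algebra_simps)
    also have "(f $ i - f $ j)\<^sup>2 - (g $ i - g $ j)\<^sup>2 = - 4 * c * E_matrix k l $ i $ j"
      using assms(2)
      by (auto simp: f_def g_def axis_def E_matrix_def power2_eq_square algebra_simps)
    finally show ?thesis by simp
  qed
  then have "generating_points q (D + (- 4 * c * \<gamma>) *\<^sub>R E_matrix k l)"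
    by (simp add: generating_points_def)
  then have "is_EDM (D + (- 4 * c * \<gamma>) *\<^sub>R E_matrix k l)"
    by (rule generating_points_imp_is_EDM)
  then show thesis using that[of "- 4 * c * \<gamma>"] \<open>\<gamma> > 0\<close> assms(3) by auto
qed

theorem theorem3p2:
  fixes D :: "real^'n^'n" and P :: "'n \<Rightarrow> nat \<Rightarrow> real" and Z :: "real^'m^'n" and k l :: 'n
  assumes "is_EDM D"
    and "embedding_dim D + 2 \<le> CARD('n)"
    and "configuration_matrix D P"
    and "gale_matrix D P Z"
    and "k \<noteq> l"
  shows "unyielding D k l \<longleftrightarrow> \<not> parallel (row k Z) (row l Z)"
proof -
  obtain p :: "'n \<Rightarrow> real^'n" where p: "generating_points p D"
    using assms(1) by (auto simp: is_EDM_def)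
  have G: "span (columns Z) = {x. (\<Sum>i\<in>UNIV. x $ i) = 0 \<and> (\<Sum>i\<in>UNIV. x $ i *\<^sub>R p i) = 0}"
    using assms(4) gale_space_eq_affine_dependences[OF assms(3) p] by (simp add: gale_matrix_def)
  have "(\<exists>t. t \<noteq> 0 \<and> is_EDM (D + t *\<^sub>R E_matrix k l)) \<longleftrightarrow> parallel (row k Z) (row l Z)"
  proof
    assume "\<exists>t. t \<noteq> 0 \<and> is_EDM (D + t *\<^sub>R E_matrix k l)"
    then obtain t where t: "t \<noteq> 0" "is_EDM (D + t *\<^sub>R E_matrix k l)" by blast
    show "parallel (row k Z) (row l Z)"
      using perturbed_EDM_imp_same_kernel[OF p t(2) assms(5) t(1)]
      by (intro parallel_rows_if_same_kernel) (simp add: G)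
  next
    assume "parallel (row k Z) (row l Z)"
    then obtain c where c: "c \<noteq> 0" "\<And>x. x \<in> span (columns Z) \<Longrightarrow> x $ k = c * x $ l"
      using parallel_rows_imp_proportional_coordinates by blast
    obtain t where "t \<noteq> 0" "is_EDM (D + t *\<^sub>R E_matrix k l)"
    proof (rule proportional_coordinates_imp_perturbed_EDM[OF p assms(5) c(1)])
    qed (use c(2) G in auto)
    then show "\<exists>t. t \<noteq> 0 \<and> is_EDM (D + t *\<^sub>R E_matrix k l)" by blast
  qed
  then show ?thesis using unyielding_iff[OF assms(1)] by blast
qed

end
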